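(* $D_{n,k}$ is the set of labeled Dyck paths of length $2n$ which end in a string of exactly $n-k$ "up-right" pairs.
   Context: A parking function of length $n$ is an $n$-tuple $(a_1,\dots,a_n)$ of positive integers which can be rearranged into weakly increasing order so that its $i$th entry is at most $i$ for every $i\in\{1,\dots,n\}$; $\mathrm{PF}_n$ is the set of these. For $1<k\le n$, $\mathrm{PF}_{n,k}$ is the set of $a\in\mathrm{PF}_n$ for which $k$ is the largest missing number, i.e. $k$ is not an entry of $a$ but each of $k+1,\dots,n$ is an entry of $a$. The remaining parking functions are those that are permutations of $(1,\dots,n)$, and they are identified with the elements of the symmetric group $\mathrm{Sym}_n$; thus $\mathrm{PF}_n=\mathrm{Sym}_n\sqcup\mathrm{PF}_{n,2}\sqcup\dots\sqcup\mathrm{PF}_{n,n}$. A Dyck path of length $2n$ is a lattice path in $\mathbb{Z}\oplus\mathbb{Z}$ from $(0,0)$ to $(n,n)$ which stays weakly above the diagonal $y=x$ and consists only of "up" steps $(0,1)$ and "right" steps $(1,0)$. A labeled Dyck path is a Dyck path for which the $n$ up steps are distinctly labeled by $\{1,\dots,n\}$. To each $(a_1,\dots,a_n)\in\mathrm{PF}_n$ one associates a labeled Dyck path of length $2n$ as follows: let $b_i$ be the number of times $i$ appears in the parking function, and draw the path from $(0,0)$ to $(n,n)$ with $b_1$ up steps followed by one right step, then $b_2$ up steps followed by one right step, and so on (the $b_i$ up steps preceding the $i$th right step are those in column $i$); then label the bottom-most unlabeled up step in column $a_1$ with $1$, the bottom-most unlabeled up step in column $a_2$ with $2$, and so on. This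 is the correspondence used between $\mathrm{PF}_n$ and labeled Dyck paths of length $2n$. $D_{n,k}$ is the set of labeled Dyck paths which correspond in this way to the parking functions in $\mathrm{PF}_{n,k}$, and $D_{n,1}$ is the set of those which correspond to the parking functions identified with $\mathrm{Sym}_n$.
   Formalization: Labels of a labeled Dyck path are required to increase from bottom to top within each column (otherwise n=k=2 fails), and for k=1 the paths are shown to end in exactly n up-right pairs, since "exactly n-1" is false; for 1<k≤n the claim is as stated. *)

theory Defs
  imports Main "HOL-Library.Multiset"
begin

definition parking_functions :: "nat \<Rightarrow> nat list set" where
  "parking_functions n =
     {a. length a = n \<and> (\<forall>x\<in>set a. 0 < x) \<and>
         (\<exists>b. mset b = mset a \<and> sorted b \<and> (\<forall>i\<in>{1..n}. b ! (i - 1) \<le> i))}"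

text \<open>Parking functions of length \<open>n\<close> whose largest missing number is \<open>k\<close>; used for \<open>1 < k \<le> n\<close>.\<close>

definition PF :: "nat \<Rightarrow> nat \<Rightarrow> nat list set" where
  "PF n k = {a \<in> parking_functions n. k \<notin> set a \<and> (\<forall>j\<in>{k+1..n}. j \<in> set a)}"

definition PF_Sym :: "nat \<Rightarrow> nat list set" where
  "PF_Sym n = {a \<in> parking_functions n. mset a = mset [1..<n+1]}"

text \<open>Lattice paths starting at the origin are lists of steps; every up step carries its label.\<close>

datatype 'l step = is_Up: Up (label: 'l) | Right

definition endpoint :: "'l step list \<Rightarrow> nat \<times> nat" where
  "endpoint p = (length (filter (\<lambda>s. \<not> is_Up s) p), length (filter is_Up p))"

definition dyck_path :: "nat \<Rightarrow> 'l step list \<Rightarrow> bool" where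
  "dyck_path n p \<longleftrightarrow> endpoint p = (n, n) \<and>
     (\<forall>m\<le>length p. fst (endpoint (take m p)) \<le> snd (endpoint (take m p)))"

definition labels :: "'l step list \<Rightarrow> 'l list" where
  "labels p = map label (filter is_Up p)"

definition column_increasing :: "nat step list \<Rightarrow> bool" where
  "column_increasing p \<longleftrightarrow>
     (\<forall>i l l'. i + 1 < length p \<and> p ! i = Up l \<and> p ! (i + 1) = Up l' \<longrightarrow> l < l')"

text \<open>
  Within a column only the set of labels is significant. As usual, a labeled Dyck path is normalised
  by letting the labels increase from bottom to top in every column. This is the normal form that
  the labeling of a parking function produces, and without it labeled Dyck paths would not
  correspond bijectively to parking functions: for \<open>n = 2\<close> the path up-up-right-right would carry
  two labelings, but only one parking function, \<open>(1,1)\<close>, has this underlying path.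
\<close>

definition labeled_dyck_paths :: "nat \<Rightarrow> nat step list set" where
  "labeled_dyck_paths n =
     {p. dyck_path n p \<and> distinct (labels p) \<and> set (labels p) = {1..n} \<and> column_increasing p}"

text \<open>
  Columns are lists of up steps from bottom to top, \<open>None\<close> marking an up step that is not labeled
  yet. The entries \<open>a\<^sub>1, \<dots>, a\<^sub>n\<close> are processed in this order; entry \<open>a\<^sub>j\<close> puts the label \<open>j\<close> on
  the bottom-most unlabeled up step of column \<open>a\<^sub>j\<close>.
\<close>

fun label_bottommost :: "nat \<Rightarrow> nat option list \<Rightarrow> nat option list" where
  "label_bottommost j [] = []"
| "label_bottommost j (None # c) = Some j # c"
| "label_bottommost j (Some l # c) = Some l # label_bottommost j c"

definition unlabeled_columns :: "nat list \<Rightarrow> nat \<Rightarrow> nat option list" where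
  "unlabeled_columns a i = replicate (count_list a i) None"

definition labeled_columns :: "nat list \<Rightarrow> nat \<Rightarrow> nat option list" where
  "labeled_columns a =
     fold (\<lambda>j cols. cols(a ! (j - 1) := label_bottommost j (cols (a ! (j - 1)))))
       [1..<length a + 1] (unlabeled_columns a)"

definition path_of :: "nat list \<Rightarrow> nat step list" where
  "path_of a =
     concat (map (\<lambda>i. map (Up \<circ> the) (labeled_columns a i) @ [Right]) [1..<length a + 1])"

definition D :: "nat \<Rightarrow> nat \<Rightarrow> nat step list set" where
  "D n k = path_of ` (if k = 1 then PF_Sym n else PF n k)"

definition ends_in_up_right_pairs :: "nat \<Rightarrow> 'l step list \<Rightarrow> bool" where
  "ends_in_up_right_pairs m p \<longleftrightarrow>
     (\<exists>q ls. length ls = m \<and> p = q @ concat (map (\<lambda>l. [Up l, Right]) ls))"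

text \<open>
  \<open>m\<close> is the maximal number of terminal up-right pairs. A Dyck path of length \<open>2n\<close> ending in \<open>n - 1\<close>
  such pairs ends in \<open>n\<close> of them, since its first two steps are then forced; so the paths in \<open>D n 1\<close>
  end in exactly \<open>n\<close> pairs, not \<open>n - 1\<close>.
\<close>

definition ends_in_exactly_up_right_pairs :: "nat \<Rightarrow> 'l step list \<Rightarrow> bool" where
  "ends_in_exactly_up_right_pairs m p \<longleftrightarrow>
     ends_in_up_right_pairs m p \<and> \<not> ends_in_up_right_pairs (m + 1) p"

end

theory Submission imports Defs begin

text \<open>
  Cut a path into its columns. In terms of columns, a Dyck path is a list of \<open>n\<close> columns with \<open>n\<close> up
  steps in total, at least \<open>i\<close> of them in the first \<open>i\<close> columns, and this is the parking condition
  on the number of entries \<open>\<le> i\<close>; hence \<open>path_of\<close> maps the parking functions onto all labeled Dyck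
  paths. The condition also bounds the length of the last column by 1, so peeling off last columns
  shows that the path ends in \<open>m\<close> up-right pairs iff its last \<open>m\<close> columns are nonempty, that is, iff
  the \<open>m\<close> largest numbers are entries of the parking function.
\<close>

section \<open>Lattice paths as lists of columns\<close>

definition path_of_columns :: "'l list list \<Rightarrow> 'l step list" where
  "path_of_columns cs = concat (map (\<lambda>c. map Up c @ [Right]) cs)"

text \<open>The Dyck condition tested only right after the \<open>Right\<close> steps, where the
  height above the diagonal is locally lowest; the equation says that the endpoint lies on the
  diagonal.\<close>

definition ballot :: "'l list list \<Rightarrow> bool" where
  "ballot cs \<longleftrightarrow> length (concat cs) = length cs \<and>
     (\<forall>i\<le>length cs. i \<le> length (concat (take i cs)))"

text \<open>The closed form of the columns that the labeling procedure fills; list index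
  \<open>i\<close> holds column \<open>Suc i\<close>.\<close>

definition label_columns :: "nat list \<Rightarrow> nat list list" where
  "label_columns a =
     map (\<lambda>i. filter (\<lambda>j. a ! (j - 1) = i) [1..<length a + 1]) [1..<length a + 1]"

lemma path_of_columns_simps [simp]:
  "path_of_columns [] = []"
  "path_of_columns (c # cs) = map Up c @ Right # path_of_columns cs"
  "path_of_columns (cs @ ds) = path_of_columns cs @ path_of_columns ds"
  by (simp_all add: path_of_columns_def)

lemma endpoint_append:
  "endpoint (p @ q) = (fst (endpoint p) + fst (endpoint q), snd (endpoint p) + snd (endpoint q))"
  by (simp add: endpoint_def)

lemma endpoint_map_Up: "endpoint (map Up c) = (0, length c)"
  by (induction c) (auto simp: endpoint_def)

lemma endpoint_path_of_columns: "endpoint (path_of_columns cs) = (length cs, length (concat cs))"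
  by (induction cs) (auto simp: endpoint_def filter_map o_def)

lemma labels_path_of_columns: "labels (path_of_columns cs) = concat cs"
  by (induction cs) (auto simp: labels_def filter_map o_def)

lemma last_path_of_columns: "path_of_columns cs = [] \<or> last (path_of_columns cs) = Right"
  by (cases cs rule: rev_cases) auto

text \<open>By induction from the front: an up step joins the first column of the rest, and a right
  step puts an empty column in front. The final \<open>Right\<close> closes the last column.\<close>

lemma ex_path_of_columns:
  assumes "p = [] \<or> last p = Right"
  shows "\<exists>cs. p = path_of_columns cs"
  using assms
proof (induction p)
  case Nil
  then show ?case by (auto intro: exI[of _ "[]"])
next
  case (Cons s p)
  then have "p = [] \<or> last p = Right"
    by (auto split: if_splits)
  with Cons.IH obtain cs where cs: "p = path_of_columns cs"
    by blast
  show ?case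
  proof (cases s)
    case (Up l)
    \<comment> \<open>If \<open>cs\<close> were empty, \<open>s # p\<close> would be the single step
      \<open>Up l\<close>, which does not end in \<open>Right\<close>.\<close>
    with Cons.prems cs obtain c cs' where "cs = c # cs'"
      by (cases cs) auto
    with Up cs have "s # p = path_of_columns ((l # c) # cs')"
      by simp
    then show ?thesis ..
  next
    case Right
    with cs have "s # p = path_of_columns ([] # cs)"
      by simp
    then show ?thesis ..
  qed
qed

text \<open>A prefix ends inside a column or just after one, so at most some up steps follow the
  complete columns.\<close>

lemma take_path_of_columns:
  "\<exists>i c. i \<le> length cs \<and> take m (path_of_columns cs) = path_of_columns (take i cs) @ map Up c"
proof (induction cs arbitrary: m)
  case Nil
  then show ?case by auto
next
  case (Cons d cs)
  show ?case
  proof (cases "m \<le> length d")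
    case True
    then have "take m (path_of_columns (d # cs)) = path_of_columns (take 0 (d # cs)) @ map Up (take m d)"
      by (simp add: take_map)
    then show ?thesis by blast
  next
    case False
    obtain i c where "i \<le> length cs"
      "take (m - length d - 1) (path_of_columns cs) = path_of_columns (take i cs) @ map Up c"
      using Cons.IH by blast
    with False have "Suc i \<le> length (d # cs) \<and> take m (path_of_columns (d # cs)) =
        path_of_columns (take (Suc i) (d # cs)) @ map Up c"
      by (simp add: take_Cons')
    then show ?thesis by blast
  qed
qed

text \<open>Cutting right after the \<open>i\<close>th right step turns the Dyck condition into the
  ballot bound for \<open>i\<close>; at any other cut the additional up steps only help.\<close>

lemma dyck_path_path_of_columns:
  "dyck_path n (path_of_columns cs) \<longleftrightarrow> length cs = n \<and> ballot cs"
proof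
  assume D: "dyck_path n (path_of_columns cs)"
  have "i \<le> length (concat (take i cs))" if "i \<le> length cs" for i
  proof -
    have "path_of_columns cs = path_of_columns (take i cs) @ path_of_columns (drop i cs)"
      by (metis append_take_drop_id path_of_columns_simps(3))
    then have "take (length (path_of_columns (take i cs))) (path_of_columns cs) = path_of_columns (take i cs)"
      and "length (path_of_columns (take i cs)) \<le> length (path_of_columns cs)"
      by simp_all
    with D have "fst (endpoint (path_of_columns (take i cs))) \<le> snd (endpoint (path_of_columns (take i cs)))"
      unfolding dyck_path_def by metis
    with that show ?thesis
      by (simp add: endpoint_path_of_columns)
  qed
  with D show "length cs = n \<and> ballot cs"
    by (auto simp: dyck_path_def ballot_def endpoint_path_of_columns)
next
  assume B: "length cs = n \<and> ballot cs"
  have "fst (endpoint (take m (path_of_columns cs))) \<le> snd (endpoint (take m (path_of_columns cs)))" for m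
  proof -
    obtain i c where "i \<le> length cs"
      "take m (path_of_columns cs) = path_of_columns (take i cs) @ map Up c"
      using take_path_of_columns by blast
    with B show ?thesis
      by (simp add: endpoint_append endpoint_map_Up endpoint_path_of_columns ballot_def trans_le_add1)
  qed
  with B show "dyck_path n (path_of_columns cs)"
    by (simp add: dyck_path_def ballot_def endpoint_path_of_columns)
qed

text \<open>Removing a final up step would leave a prefix with \<open>n\<close> right steps but only
  \<open>n - 1\<close> up steps, which ends below the diagonal.\<close>

lemma dyck_path_last:
  assumes "dyck_path n p"
  shows "p = [] \<or> last p = Right"
proof (rule ccontr)
  assume "\<not> (p = [] \<or> last p = Right)"
  then obtain q l where p: "p = q @ [Up l]"
    by (metis append_butlast_last_id step.exhaust)
  have "fst (endpoint q) \<le> snd (endpoint q)"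
    using assms unfolding dyck_path_def p by (auto dest: spec[of _ "length q"])
  moreover have "endpoint p = (n, n)"
    using assms by (simp add: dyck_path_def)
  ultimately show False
    by (simp add: p endpoint_def)
qed

text \<open>\<open>successively\<close> comes with rules for append and \<open>map\<close>, which
  the induction over columns relies on.\<close>

lemma column_increasing_iff_successively:
  "column_increasing p \<longleftrightarrow> successively (\<lambda>s t. \<forall>l l'. s = Up l \<and> t = Up l' \<longrightarrow> l < l') p"
  by (auto simp: column_increasing_def successively_conv_nth)

text \<open>The right step closing each column separates it from the next, so labels are compared
  only within a column; transitivity of \<open><\<close> turns adjacent comparisons into
  sortedness.\<close>

lemma column_increasing_path_of_columns:
  "column_increasing (path_of_columns cs) \<longleftrightarrow> (\<forall>c\<in>set cs. sorted_wrt (<) c)"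
  by (induction cs)
    (auto simp: column_increasing_iff_successively successively_append_iff successively_Cons
       successively_map successively_iff_sorted_wrt_strong)

lemma labeled_dyck_paths_iff:
  "p \<in> labeled_dyck_paths n \<longleftrightarrow>
     (\<exists>cs. p = path_of_columns cs \<and> length cs = n \<and> ballot cs \<and> distinct (concat cs) \<and>
           set (concat cs) = {1..n} \<and> (\<forall>c\<in>set cs. sorted_wrt (<) c))"
proof
  assume p: "p \<in> labeled_dyck_paths n"
  then have "dyck_path n p"
    by (simp add: labeled_dyck_paths_def)
  then obtain cs where "p = path_of_columns cs"
    using ex_path_of_columns[OF dyck_path_last] by blast
  with p show "\<exists>cs. p = path_of_columns cs \<and> length cs = n \<and> ballot cs \<and> distinct (concat cs) \<and>
      set (concat cs) = {1..n} \<and> (\<forall>c\<in>set cs. sorted_wrt (<) c)"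
    unfolding labeled_dyck_paths_def
    by (auto simp only: mem_Collect_eq dyck_path_path_of_columns labels_path_of_columns
        column_increasing_path_of_columns)
qed (auto simp only: labeled_dyck_paths_def mem_Collect_eq dyck_path_path_of_columns
      labels_path_of_columns column_increasing_path_of_columns)

section \<open>The labeling procedure in closed form\<close>

lemma label_bottommost_map_Some:
  "label_bottommost j (map Some xs @ None # c) = map Some (xs @ [j]) @ c"
  by (induction xs) auto

lemma labeled_columns_eq:
  "labeled_columns a i = map Some (filter (\<lambda>j. a ! (j - 1) = i) [1..<length a + 1])"
proof -
  \<comment> \<open>Loop invariant: after \<open>m\<close> entries, column \<open>i\<close> carries
    at its bottom the labels up to \<open>m\<close> that belong to it, and above them one
    \<open>None\<close> for each occurrence of \<open>i\<close> still to come.\<close>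
  have "fold (\<lambda>j cols. cols(a ! (j - 1) := label_bottommost j (cols (a ! (j - 1)))))
          [1..<m + 1] (unlabeled_columns a) i =
        map Some (filter (\<lambda>j. a ! (j - 1) = i) [1..<m + 1]) @ replicate (count_list (drop m a) i) None"
    if "m \<le> length a" for m
    using that
  proof (induction m arbitrary: i)
    case 0
    then show ?case by (simp add: unlabeled_columns_def)
  next
    case (Suc m)
    \<comment> \<open>If \<open>a ! m = i\<close>, an occurrence of \<open>i\<close> is still to
      come, so column \<open>i\<close> has a \<open>None\<close> for the label
      \<open>Suc m\<close>.\<close>
    then have "drop m a = a ! m # drop (Suc m) a"
      by (simp add: Cons_nth_drop_Suc)
    with Suc show ?case
      by (auto simp: label_bottommost_map_Some simp del: map_append)
  qed
  from this[of "length a"] show ?thesis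
    by (simp add: labeled_columns_def)
qed

lemma path_of_eq: "path_of a = path_of_columns (label_columns a)"
  by (simp add: path_of_def path_of_columns_def label_columns_def labeled_columns_eq o_def)

section \<open>Parking functions and the ballot condition\<close>

text \<open>The number of entries at most \<open>i\<close> is invariant under rearrangement, and for
  a sorted list it is at least \<open>i\<close> exactly when the \<open>i\<close>th entry is at most
  \<open>i\<close>.\<close>

lemma parking_functions_iff:
  "a \<in> parking_functions n \<longleftrightarrow>
     length a = n \<and> 0 \<notin> set a \<and> (\<forall>i\<le>n. i \<le> length (filter (\<lambda>x. x \<le> i) a))"
proof -
  have *: "(\<forall>i\<in>{1..n}. b ! (i - 1) \<le> i) \<longleftrightarrow> (\<forall>i\<le>n. i \<le> length (filter (\<lambda>x. x \<le> i) a))"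
    if b: "mset b = mset a" "sorted b" and n: "length a = n" for b :: "nat list"
  proof -
    have len: "length b = n"
      using b n by (metis size_mset)
    have card: "length (filter (\<lambda>x. x \<le> i) a) = card {j. j < n \<and> b ! j \<le> i}" for i
    proof -
      have "length (filter (\<lambda>x. x \<le> i) a) = length (filter (\<lambda>x. x \<le> i) b)"
        using b(1) by (metis mset_filter size_mset)
      then show ?thesis
        by (simp add: length_filter_conv_card len)
    qed
    have "b ! (i - 1) \<le> i \<longleftrightarrow> i \<le> card {j. j < n \<and> b ! j \<le> i}" if i: "1 \<le> i" "i \<le> n" for i
    proof
      assume le: "b ! (i - 1) \<le> i"
      have "b ! j \<le> i" if "j < i" for j
      proof -
        have "j \<le> i - 1" "i - 1 < length b"
          using that i len by linarith+
        then show ?thesis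
          using sorted_nth_mono[OF b(2)] le by (meson le_trans)
      qed
      then have "{..<i} \<subseteq> {j. j < n \<and> b ! j \<le> i}"
        using i by auto
      from card_mono[OF _ this] show "i \<le> card {j. j < n \<and> b ! j \<le> i}"
        by simp
    next
      assume ge: "i \<le> card {j. j < n \<and> b ! j \<le> i}"
      show "b ! (i - 1) \<le> i"
      proof (rule ccontr)
        assume "\<not> b ! (i - 1) \<le> i"
        \<comment> \<open>By sortedness every entry from index \<open>i - 1\<close> on exceeds
          \<open>i\<close>, so at most \<open>i - 1\<close> entries are counted.\<close>
        then have "\<not> b ! j \<le> i" if "i - 1 \<le> j" "j < n" for j
          using sorted_nth_mono[OF b(2), of "i - 1" j] len that by simp
        then have "{j. j < n \<and> b ! j \<le> i} \<subseteq> {..<i - 1}"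
          by (auto simp: not_le[symmetric])
        from card_mono[OF _ this] ge i show False
          by simp
      qed
    qed
    then show ?thesis
      by (auto simp: card Suc_le_eq)
  qed
  \<comment> \<open>\<open>sort a\<close> is the rearrangement that witnesses the existential in
    \<open>parking_functions\<close>.\<close>
  have "mset (sort a) = mset a" "sorted (sort a)"
    by simp_all
  with * show ?thesis
    unfolding parking_functions_def mem_Collect_eq by (metis gr0I less_irrefl)
qed

text \<open>The first \<open>i\<close> columns hold the positions whose entries lie in
  \<open>{1..i}\<close>; as 0 is excluded, these are all entries at most \<open>i\<close>.\<close>

lemma length_concat_take_label_columns:
  assumes "0 \<notin> set a" "i \<le> length a"
  shows "length (concat (take i (label_columns a))) = length (filter (\<lambda>x. x \<le> i) a)"
proof -
  \<comment> \<open>The fibres of \<open>f\<close> over \<open>1, ..., k\<close> are disjoint, so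
    their sizes add up to the size of their union.\<close>
  have fibres: "length (concat (map (\<lambda>i. filter (\<lambda>j. f j = i) xs) [1..<k + 1])) =
      length (filter (\<lambda>j. 1 \<le> f j \<and> f j \<le> k) xs)" for f :: "nat \<Rightarrow> nat" and xs k
  proof (induction k)
    case (Suc k)
    have "length (filter (\<lambda>j. 1 \<le> f j \<and> f j \<le> Suc k) xs) =
        length (filter (\<lambda>j. 1 \<le> f j \<and> f j \<le> k) xs) + length (filter (\<lambda>j. f j = Suc k) xs)"
      by (induction xs) auto
    with Suc show ?case by simp
  qed auto
  have a: "map (\<lambda>j. a ! (j - 1)) [1..<length a + 1] = a"
  proof -
    have "[1..<length a + 1] = map Suc [0..<length a]"
      by (simp only: map_Suc_upt One_nat_def add_Suc_right add_0_right)
    then show ?thesis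
      by (simp only: map_map o_def diff_Suc_1 map_nth)
  qed
  have "take i [1..<length a + 1] = [1..<i + 1]"
    using take_upt[of 1 i "length a + 1"] assms(2) by (simp add: add.commute del: upt_Suc)
  then have "length (concat (take i (label_columns a))) =
      length (filter (\<lambda>j. 1 \<le> a ! (j - 1) \<and> a ! (j - 1) \<le> i) [1..<length a + 1])"
    by (simp only: label_columns_def take_map fibres)
  also have "\<dots> = length (filter (\<lambda>x. 1 \<le> x \<and> x \<le> i) (map (\<lambda>j. a ! (j - 1)) [1..<length a + 1]))"
    by (simp only: filter_map length_map o_def)
  also have "\<dots> = length (filter (\<lambda>x. x \<le> i) a)"
    unfolding a using assms(1) by (metis (mono_tags, lifting) One_nat_def Suc_leI filter_cong gr0I)
  finally show ?thesis .
qed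

lemma length_label_columns [simp]: "length (label_columns a) = length a"
  by (simp add: label_columns_def del: upt_Suc)

text \<open>At \<open>i = length a\<close> the counting bound forces all entries of \<open>a\<close>
  to be counted, which yields the equation in \<open>ballot\<close>.\<close>

lemma parking_functions_iff_ballot:
  "a \<in> parking_functions n \<longleftrightarrow> length a = n \<and> 0 \<notin> set a \<and> ballot (label_columns a)"
proof -
  have "ballot (label_columns a) \<longleftrightarrow> (\<forall>i\<le>length a. i \<le> length (filter (\<lambda>x. x \<le> i) a))" if "0 \<notin> set a"
  proof -
    have "length (concat (label_columns a)) = length (filter (\<lambda>x. x \<le> length a) a)"
      using length_concat_take_label_columns[OF that, of "length a"] by simp
    then show ?thesis
      unfolding ballot_def using length_concat_take_label_columns[OF that] length_filter_le
      by (auto intro: antisym)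
  qed
  then show ?thesis
    by (auto simp: parking_functions_iff)
qed

text \<open>At least \<open>n\<close> of the \<open>n\<close> entries are at most \<open>n\<close>,
  so all of them are.\<close>

lemma parking_functions_le:
  assumes "a \<in> parking_functions n" "x \<in> set a"
  shows "x \<le> n"
proof -
  have "length (filter (\<lambda>x. x \<le> n) a) = length a"
    using assms(1) by (auto simp: parking_functions_iff intro: antisym)
  with assms(2) show ?thesis
    by (metis length_filter_less less_irrefl)
qed

lemma nth_label_columns:
  "i < length a \<Longrightarrow> label_columns a ! i = filter (\<lambda>j. a ! (j - 1) = Suc i) [1..<length a + 1]"
  by (simp add: label_columns_def del: upt_Suc)

text \<open>This links the missing numbers of a parking function to the empty columns of its
  path.\<close>

lemma nth_label_columns_eq_Nil_iff:
  assumes "i < length a"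
  shows "label_columns a ! i = [] \<longleftrightarrow> Suc i \<notin> set a"
proof -
  have "Suc i \<in> set a \<longleftrightarrow> (\<exists>j\<in>{1..<length a + 1}. a ! (j - 1) = Suc i)"
  proof
    assume "Suc i \<in> set a"
    then obtain j where "j < length a" "a ! j = Suc i"
      by (auto simp: in_set_conv_nth)
    then show "\<exists>j\<in>{1..<length a + 1}. a ! (j - 1) = Suc i"
      by (intro bexI[of _ "Suc j"]) auto
  next
    assume "\<exists>j\<in>{1..<length a + 1}. a ! (j - 1) = Suc i"
    then obtain j where "1 \<le> j" "j < length a + 1" "a ! (j - 1) = Suc i"
      by auto
    then have "j - 1 < length a" "a ! (j - 1) = Suc i"
      by linarith+
    then show "Suc i \<in> set a"
      by (metis nth_mem)
  qed
  with assms show ?thesis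
    by (simp add: nth_label_columns filter_empty_conv del: upt_Suc)
qed

section \<open>Parking functions map onto labeled Dyck paths\<close>

text \<open>Each label lies in some column because the entries lie in \<open>{1..n}\<close>.
  Distinctness comes by counting: the columns hold \<open>n\<close> labels in total, and these fill
  a set of size \<open>n\<close>.\<close>

lemma path_of_in_labeled_dyck_paths:
  assumes a: "a \<in> parking_functions n"
  shows "path_of a \<in> labeled_dyck_paths n"
proof -
  have n: "length a = n" and "0 \<notin> set a" and B: "ballot (label_columns a)"
    using a by (auto simp: parking_functions_iff_ballot)
  have range: "a ! (j - 1) \<in> {1..n}" if "j \<in> {1..n}" for j
  proof -
    have "a ! (j - 1) \<in> set a"
      using that n by auto
    with parking_functions_le[OF a] \<open>0 \<notin> set a\<close> show ?thesis
      by (metis One_nat_def Suc_leI atLeastAtMost_iff gr0I)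
  qed
  have "set (concat (label_columns a)) = {j \<in> {1..n}. a ! (j - 1) \<in> {1..n}}"
    by (auto simp: label_columns_def n simp del: upt_Suc)
  also have "\<dots> = {1..n}"
    using range by blast
  finally have set: "set (concat (label_columns a)) = {1..n}" .
  then have "card (set (concat (label_columns a))) = n"
    by simp
  moreover have "length (concat (label_columns a)) = n"
    using B n by (simp add: ballot_def)
  ultimately have "distinct (concat (label_columns a))"
    by (metis card_distinct)
  moreover have "\<forall>c\<in>set (label_columns a). sorted_wrt (<) c"
    by (auto simp: label_columns_def sorted_wrt_filter simp del: upt_Suc)
  ultimately show ?thesis
    unfolding labeled_dyck_paths_iff path_of_eq using n B set by auto
qed

text \<open>Used to see that a label determines its column.\<close>

lemma distinct_concat_nth_eq:
  assumes "distinct (concat cs)" "i < length cs" "j < length cs" "x \<in> set (cs ! i)" "x \<in> set (cs ! j)"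
  shows "i = j"
  using assms
proof (induction cs arbitrary: i j)
  case (Cons c cs)
  have "x \<notin> set (cs ! k)" if "x \<in> set c" "k < length cs" for k
    using Cons.prems(1) that nth_mem[of k cs] by fastforce
  with Cons show ?case
    by (cases i; cases j) auto
qed simp

text \<open>The preimage is read off the path: entry \<open>j\<close> of the parking function is the
  number of the column containing the label \<open>j\<close>.\<close>

lemma labeled_dyck_path_imp_path_of:
  assumes "p \<in> labeled_dyck_paths n"
  shows "p \<in> path_of ` parking_functions n"
proof -
  obtain cs where p: "p = path_of_columns cs" and n: "length cs = n" and B: "ballot cs"
    and dist: "distinct (concat cs)" and set: "set (concat cs) = {1..n}"
    and sorted: "\<And>c. c \<in> set cs \<Longrightarrow> sorted_wrt (<) c"
    using assms unfolding labeled_dyck_paths_iff by blast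
  have "\<exists>i<n. j \<in> set (cs ! i)" if "j \<in> {1..n}" for j
  proof -
    from that obtain c where "c \<in> set cs" "j \<in> set c"
      unfolding set[symmetric] by auto
    then show ?thesis
      using n by (metis in_set_conv_nth)
  qed
  then obtain col where col: "\<And>j. j \<in> {1..n} \<Longrightarrow> col j < n \<and> j \<in> set (cs ! col j)"
    by metis
  \<comment> \<open>\<open>col\<close> gives a 0-based list index while columns are numbered from 1,
    hence \<open>Suc\<close>.\<close>
  define a where "a = map (\<lambda>j. Suc (col j)) [1..<n + 1]"
  have len: "length a = n"
    by (simp add: a_def)
  have "label_columns a = cs"
  proof (rule nth_equalityI)
    fix i assume "i < length (label_columns a)"
    then have i: "i < n"
      by (simp add: len)
    have "set (filter (\<lambda>j. a ! (j - 1) = Suc i) [1..<n + 1]) = {j \<in> {1..n}. col j = i}"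
      by (auto simp: a_def simp del: upt_Suc)
    also have "\<dots> = set (cs ! i)"
    proof
      show "set (cs ! i) \<subseteq> {j \<in> {1..n}. col j = i}"
      proof
        fix j assume j: "j \<in> set (cs ! i)"
        then have "j \<in> {1..n}"
          using i n unfolding set[symmetric] by auto
        moreover from this have "col j = i"
          using distinct_concat_nth_eq[OF dist] col i j n by blast
        ultimately show "j \<in> {j \<in> {1..n}. col j = i}"
          by simp
      qed
    qed (use col in auto)
    \<comment> \<open>Strictly increasing lists with equal sets are equal; here the normal form of
      the labels enters.\<close>
    finally have "filter (\<lambda>j. a ! (j - 1) = Suc i) [1..<n + 1] = cs ! i"
      using sorted[of "cs ! i"] i n
      by (intro strict_sorted_equal) (auto simp: sorted_wrt_filter simp del: upt_Suc)
    then show "label_columns a ! i = cs ! i"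
      using i by (simp add: nth_label_columns len del: upt_Suc)
  qed (simp add: len n)
  then have "a \<in> parking_functions n" "path_of a = p"
    using B len p by (auto simp: parking_functions_iff_ballot path_of_eq a_def)
  then show ?thesis
    by blast
qed

lemma path_of_parking_functions: "path_of ` parking_functions n = labeled_dyck_paths n"
  using path_of_in_labeled_dyck_paths labeled_dyck_path_imp_path_of by blast

section \<open>Terminal up-right pairs\<close>

lemma ends_in_up_right_pairs_0 [simp]: "ends_in_up_right_pairs 0 p"
  by (simp add: ends_in_up_right_pairs_def)

lemma ends_in_up_right_pairs_Suc:
  "ends_in_up_right_pairs (Suc m) p \<longleftrightarrow>
     (\<exists>q l. p = q @ [Up l, Right] \<and> ends_in_up_right_pairs m q)"
proof
  assume "ends_in_up_right_pairs (Suc m) p"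
  then obtain q ls where ls: "length ls = Suc m" "p = q @ concat (map (\<lambda>l. [Up l, Right]) ls)"
    by (auto simp: ends_in_up_right_pairs_def)
  then obtain ks l where "ls = ks @ [l]"
    by (metis length_Suc_conv_rev)
  with ls show "\<exists>q l. p = q @ [Up l, Right] \<and> ends_in_up_right_pairs m q"
    by (auto simp: ends_in_up_right_pairs_def)
next
  assume "\<exists>q l. p = q @ [Up l, Right] \<and> ends_in_up_right_pairs m q"
  then obtain q l r ls where "p = q @ [Up l, Right]" "length ls = m"
    "q = r @ concat (map (\<lambda>l. [Up l, Right]) ls)"
    by (auto simp: ends_in_up_right_pairs_def)
  then have "length (ls @ [l]) = Suc m \<and> p = r @ concat (map (\<lambda>l. [Up l, Right]) (ls @ [l]))"
    by simp
  then show "ends_in_up_right_pairs (Suc m) p"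
    unfolding ends_in_up_right_pairs_def by blast
qed

text \<open>Peel off the last column, which the ballot condition limits to one up step: an empty
  column stops the string of pairs, a singleton contributes one pair.\<close>

lemma ends_in_up_right_pairs_path_of_columns:
  assumes "ballot cs"
  shows "ends_in_up_right_pairs m (path_of_columns cs) \<longleftrightarrow>
    m \<le> length cs \<and> [] \<notin> set (drop (length cs - m) cs)"
  using assms
proof (induction cs arbitrary: m rule: rev_induct)
  case Nil
  then show ?case
    by (cases m) (auto simp: ends_in_up_right_pairs_Suc)
next
  case (snoc c cs)
  have total: "length (concat cs) + length c = Suc (length cs)"
    using snoc.prems by (simp add: ballot_def)
  have "i \<le> length (concat (take i cs))" if "i \<le> length cs" for i
    using snoc.prems[unfolded ballot_def, THEN conjunct2, rule_format, of i] that by simp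
  note prefix = this
  \<comment> \<open>The columns before the last contain at least \<open>length cs\<close> of the
    \<open>Suc (length cs)\<close> up steps.\<close>
  from prefix[of "length cs"] total have "length c \<le> 1"
    by simp
  then consider "c = []" | l where "c = [l]"
    by (cases c) auto
  then show ?case
  proof cases
    case 1
    \<comment> \<open>The final \<open>Right\<close> is preceded by nothing or by another
      \<open>Right\<close>, so the path does not end in a pair.\<close>
    then show ?thesis
      using last_path_of_columns[of cs]
      by (cases m) (auto simp: ends_in_up_right_pairs_Suc)
  next
    case 2
    \<comment> \<open>Removing a singleton column lowers the numbers of columns and of up steps both
      by one.\<close>
    with total prefix have "ballot cs"
      by (simp add: ballot_def)
    with snoc.IH 2 show ?thesis
      by (cases m) (auto simp: ends_in_up_right_pairs_Suc)
  qed
qed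

lemma in_set_drop_iff: "x \<in> set (drop d xs) \<longleftrightarrow> (\<exists>i<length xs. d \<le> i \<and> xs ! i = x)"
proof
  assume "x \<in> set (drop d xs)"
  then obtain j where "j < length (drop d xs)" "drop d xs ! j = x"
    by (metis in_set_conv_nth)
  then show "\<exists>i<length xs. d \<le> i \<and> xs ! i = x"
    by (intro exI[of _ "d + j"]) simp
next
  assume "\<exists>i<length xs. d \<le> i \<and> xs ! i = x"
  then obtain i where "i < length xs" "d \<le> i" "xs ! i = x"
    by blast
  then show "x \<in> set (drop d xs)"
    unfolding in_set_conv_nth by (intro exI[of _ "i - d"]) simp
qed

text \<open>Column \<open>x\<close> is empty exactly when \<open>x\<close> is missing; list index
  \<open>i\<close> stands for the number \<open>i + 1\<close>, hence the lower bound
  \<open>n - m + 1\<close>.\<close>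

lemma ends_in_up_right_pairs_path_of:
  assumes "a \<in> parking_functions n"
  shows "ends_in_up_right_pairs m (path_of a) \<longleftrightarrow> m \<le> n \<and> {n - m + 1..n} \<subseteq> set a"
proof -
  have n: "length a = n" and B: "ballot (label_columns a)"
    using assms by (auto simp: parking_functions_iff_ballot)
  have "[] \<notin> set (drop (n - m) (label_columns a)) \<longleftrightarrow> (\<forall>i<n. n - m \<le> i \<longrightarrow> label_columns a ! i \<noteq> [])"
    using n by (auto simp: in_set_drop_iff)
  also have "\<dots> \<longleftrightarrow> (\<forall>i<n. n - m \<le> i \<longrightarrow> Suc i \<in> set a)"
    using n by (simp add: nth_label_columns_eq_Nil_iff)
  also have "\<dots> \<longleftrightarrow> {n - m + 1..n} \<subseteq> set a"
  proof
    assume *: "\<forall>i<n. n - m \<le> i \<longrightarrow> Suc i \<in> set a"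
    show "{n - m + 1..n} \<subseteq> set a"
    proof
      fix x assume "x \<in> {n - m + 1..n}"
      with *[rule_format, of "x - 1"] show "x \<in> set a"
        by auto
    qed
  qed auto
  finally show ?thesis
    using ends_in_up_right_pairs_path_of_columns[OF B, of m] by (simp add: path_of_eq n)
qed

section \<open>Largest missing numbers and permutations\<close>

text \<open>Asking for one more pair adds only \<open>k\<close> to the required entries, so
  exactness means that \<open>k\<close> is missing while all larger numbers up to \<open>n\<close>
  occur.\<close>

lemma PF_eq:
  assumes "1 \<le> k" "k \<le> n"
  shows "PF n k = {a \<in> parking_functions n. ends_in_exactly_up_right_pairs (n - k) (path_of a)}"
proof -
  have "ends_in_exactly_up_right_pairs (n - k) (path_of a) \<longleftrightarrow> k \<notin> set a \<and> (\<forall>j\<in>{k+1..n}. j \<in> set a)"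
    if "a \<in> parking_functions n" for a
  proof -
    have exactly: "ends_in_exactly_up_right_pairs (n - k) (path_of a) \<longleftrightarrow>
        {k + 1..n} \<subseteq> set a \<and> \<not> {n - (n - k + 1) + 1..n} \<subseteq> set a"
      using assms that
      by (simp add: ends_in_exactly_up_right_pairs_def ends_in_up_right_pairs_path_of Suc_le_eq)
    \<comment> \<open>As \<open>1 \<le> k \<le> n\<close>, no subtraction is truncated and the lower
      bound equals \<open>k\<close>.\<close>
    have insert: "{n - (n - k + 1) + 1..n} = insert k {k + 1..n}"
      using assms by auto
    show ?thesis
      unfolding exactly insert by blast
  qed
  then show ?thesis
    unfolding PF_def by blast
qed

text \<open>A parking function containing all of \<open>1, ..., n\<close> is a permutation, since it
  has only \<open>n\<close> entries; \<open>n + 1\<close> pairs never occur, because there are only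
  \<open>n\<close> columns.\<close>

lemma PF_Sym_eq:
  "PF_Sym n = {a \<in> parking_functions n. ends_in_exactly_up_right_pairs n (path_of a)}"
proof -
  have upt: "set [1..<n + 1] = {1..n}"
    by (simp only: set_upt Suc_eq_plus1[symmetric] atLeastLessThanSuc_atLeastAtMost)
  have "mset a = mset [1..<n + 1] \<longleftrightarrow> {1..n} \<subseteq> set a" if a: "a \<in> parking_functions n" for a
  proof
    assume "mset a = mset [1..<n + 1]"
    then have "set a = set [1..<n + 1]"
      by (rule mset_eq_setD)
    then show "{1..n} \<subseteq> set a"
      by (simp only: upt)
  next
    assume sub: "{1..n} \<subseteq> set a"
    have "set a \<subseteq> {1..n}"
      using parking_functions_le[OF a] a
      by (auto simp: parking_functions_iff Suc_le_eq intro: gr0I)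
    with sub have set: "set a = set [1..<n + 1]"
      unfolding upt by blast
    moreover have "length a = n"
      using a by (simp add: parking_functions_iff)
    ultimately have "distinct a"
      by (simp add: card_distinct del: upt_Suc)
    with set show "mset a = mset [1..<n + 1]"
      by (metis set_eq_iff_mset_eq_distinct distinct_upt)
  qed
  then show ?thesis
    unfolding PF_Sym_def
    by (auto simp: ends_in_exactly_up_right_pairs_def ends_in_up_right_pairs_path_of simp del: upt_Suc)
qed

theorem theorem4p4:
  fixes n :: nat
  shows "(\<forall>k. 1 < k \<and> k \<le> n \<longrightarrow>
            D n k = {p \<in> labeled_dyck_paths n. ends_in_exactly_up_right_pairs (n - k) p}) \<and>
         D n 1 = {p \<in> labeled_dyck_paths n. ends_in_exactly_up_right_pairs n p}"
  \<comment> \<open>With \<open>labeled_dyck_paths n\<close> written as the image of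
    \<open>parking_functions n\<close>, both sides become images under \<open>path_of\<close> of the
    parking functions selected by a property of their path.\<close>
  unfolding D_def path_of_parking_functions[symmetric]
  by (auto simp: PF_eq PF_Sym_eq)

end
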